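(* The following problem can be polytime-reduced to the restricted polynomial equivalence problem over $\mathrm{Mat}_2(\mathbb{Z}_2)$: given $k,n\in\mathbb{N}$ and expanded polynomials $p_1,\dots,p_k\in\mathbb{Z}_3[x_1,\dots,x_n]$, decide whether $\sum_{i=1}^k\alpha^{p_i(\mathbf{a})}=0$ for all $\mathbf{a}\in\{-1,1\}^n$.
   Context: $\alpha$ is a primitive element of the field $\mathbb{F}_4$ (e.g. $\alpha=\begin{pmatrix}0&1\\1&1\end{pmatrix}$ in $\mathbb{F}_4=\{0,\alpha,\alpha^2,I\}\subseteq\mathrm{Mat}_2(\mathbb{Z}_2)$); since $\alpha^3=1$, $\alpha^t$ is defined for $t\in\mathbb{Z}_3$; $p_i(\mathbf{a})$ is computed in $\mathbb{Z}_3$ and the sum is taken in $\mathbb{F}_4$. An expanded polynomial is given as $\sum_{\mathbf{e}\in I}c_{\mathbf{e}}x_1^{e_1}\cdots x_n^{e_n}$ with $I\subseteq\{0,1,2\}^n$ and $c_{\mathbf{e}}\in\mathbb{Z}_3\setminus\{0\}$. A restricted polynomial expression over $\mathrm{Mat}_2(\mathbb{Z}_2)$ is a finite, possibly empty, formal sum of nonempty words over noncommuting variables and elements of $\mathrm{GL}_2(\mathbb{Z}_2)$, evaluated in the matrix ring; the restricted polynomial equivalence problem asks, given such $p$ in variables $x_1,\dots,x_n$, whether $p(\mathbf{x})=0$ for all $\mathbf{x}\in\mathrm{GL}_2(\mathbb{Z}_2)^n$. Polytime-reducible: there is a polynomial-time transformation $P$ of inputs with $A(e)\iff B(P(e))$.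 *)

theory Defs
  imports
    "HOL-Analysis.Analysis"
    "HOL-Library.Z2"
    "HOL-Computational_Algebra.Polynomial"
begin

section \<open>Deterministic multi-tape Turing machines\<close>

text \<open>
  Tapes are infinite in both directions and symbol \<open>0\<close> is the blank. Computation starts in
  state \<open>0\<close> and stops in state \<open>1\<close>. The input is on the first tape, the output on the last one
  (these coincide if there is just one tape).
\<close>

datatype move = Left | Stay | Right

record tm =
  tapes :: nat
  symbols :: nat
  states :: nat
  delta :: "nat \<Rightarrow> nat list \<Rightarrow> nat \<times> (nat \<times> move) list"

text \<open>\<open>delta\<close> is a total function of the logic; only its finitely many values on states below
  \<open>states\<close> and symbols below \<open>symbols\<close> matter.\<close>

definition wf_tm :: "tm \<Rightarrow> bool" where
  "wf_tm M \<longleftrightarrow> tapes M \<ge> 1 \<and> symbols M \<ge> 1 \<and> states M \<ge> 2 \<and>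
     (\<forall>q rs. q < states M \<and> length rs = tapes M \<and> set rs \<subseteq> {..<symbols M} \<longrightarrow>
        (case delta M q rs of (q', acts) \<Rightarrow>
           q' < states M \<and> length acts = tapes M \<and> fst ` set acts \<subseteq> {..<symbols M}))"

type_synonym tape = "(int \<Rightarrow> nat) \<times> int"
type_synonym config = "nat \<times> tape list"

fun move_head :: "move \<Rightarrow> int \<Rightarrow> int" where
  "move_head Left h = h - 1"
| "move_head Stay h = h"
| "move_head Right h = h + 1"

fun read_tape :: "tape \<Rightarrow> nat" where
  "read_tape (f, h) = f h"

fun act_tape :: "nat \<times> move \<Rightarrow> tape \<Rightarrow> tape" where
  "act_tape (s, d) (f, h) = (f(h := s), move_head d h)"

fun tm_step :: "tm \<Rightarrow> config \<Rightarrow> config" where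
  "tm_step M (q, ts) =
     (if q = 1 then (q, ts)
      else case delta M q (map read_tape ts) of (q', acts) \<Rightarrow> (q', map2 act_tape acts ts))"

definition tape_content :: "nat list \<Rightarrow> int \<Rightarrow> nat" where
  "tape_content w i = (if 0 \<le> i \<and> nat i < length w then w ! nat i else 0)"

definition start_config :: "tm \<Rightarrow> nat list \<Rightarrow> config" where
  "start_config M w = (0, (tape_content w, 0) # replicate (tapes M - 1) (\<lambda>_. 0, 0))"

definition tm_computes_within :: "tm \<Rightarrow> nat list \<Rightarrow> nat list \<Rightarrow> nat \<Rightarrow> bool" where
  "tm_computes_within M w v T \<longleftrightarrow>
     (\<exists>t\<le>T. case (tm_step M ^^ t) (start_config M w) of (q, ts) \<Rightarrow>
        q = 1 \<and> fst (last ts) = tape_content v)"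

section \<open>Decision problems and polynomial-time reductions\<close>

record 'a problem =
  inputs :: "'a set"
  encode :: "'a \<Rightarrow> nat list"
  holds :: "'a \<Rightarrow> bool"

definition polytime_transformation :: "'a problem \<Rightarrow> 'b problem \<Rightarrow> ('a \<Rightarrow> 'b) \<Rightarrow> bool" where
  "polytime_transformation A B P \<longleftrightarrow>
     (\<forall>e\<in>inputs A. P e \<in> inputs B) \<and>
     (\<exists>M (q :: nat poly). wf_tm M \<and>
        (\<forall>e\<in>inputs A. set (encode A e) \<subseteq> {1..<symbols M} \<and> set (encode B (P e)) \<subseteq> {1..<symbols M} \<and>
           tm_computes_within M (encode A e) (encode B (P e)) (poly q (length (encode A e)))))"

definition polytime_reducible :: "'a problem \<Rightarrow> 'b problem \<Rightarrow> bool" where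
  "polytime_reducible A B \<longleftrightarrow>
     (\<exists>P. polytime_transformation A B P \<and> (\<forall>e\<in>inputs A. holds A e \<longleftrightarrow> holds B (P e)))"

section \<open>The matrix ring over the field with two elements\<close>

type_synonym mat2 = "bit ^ 2 ^ 2"

definition GL2 :: "mat2 set" where
  "GL2 = {A. invertible A}"

text \<open>The class operations \<open>*\<close> and \<open>^\<close> on vectors act componentwise, so powers of matrices
  have to be defined separately.\<close>

primrec mat_power :: "mat2 \<Rightarrow> nat \<Rightarrow> mat2" where
  "mat_power A 0 = mat 1"
| "mat_power A (Suc m) = A ** mat_power A m"

definition alpha0 :: mat2 where
  "alpha0 = vector [vector [0, 1], vector [1, 1]]"

definition F4 :: "mat2 set" where
  "F4 = {0, alpha0, mat_power alpha0 2, mat 1}"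

definition primitive_F4 :: "mat2 \<Rightarrow> bool" where
  "primitive_F4 A \<longleftrightarrow> A \<in> F4 \<and> (\<forall>B\<in>F4 - {0}. \<exists>m. B = mat_power A m)"

text \<open>The exponent is an element of the ring of integers modulo 3 (the numeral type \<open>3\<close>); the
  choice of representative is immaterial when the cube of the matrix is the identity.\<close>

definition mat_power_Z3 :: "mat2 \<Rightarrow> 3 \<Rightarrow> mat2" where
  "mat_power_Z3 A t = mat_power A (LEAST m. of_nat m = t)"

section \<open>Sums of powers with expanded polynomials as exponents\<close>

text \<open>An expanded polynomial is the list of its pairs of exponent vector and coefficient.
  Variables are numbered from \<open>0\<close>.\<close>

type_synonym xpoly = "(nat list \<times> 3) list"

definition expanded_poly :: "nat \<Rightarrow> xpoly \<Rightarrow> bool" where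
  "expanded_poly n p \<longleftrightarrow> distinct (map fst p) \<and>
     (\<forall>(e, c)\<in>set p. length e = n \<and> set e \<subseteq> {0, 1, 2} \<and> c \<noteq> 0)"

definition eval_xpoly :: "nat \<Rightarrow> xpoly \<Rightarrow> (nat \<Rightarrow> 3) \<Rightarrow> 3" where
  "eval_xpoly n p a = (\<Sum>(e, c)\<leftarrow>p. c * (\<Prod>j<n. a j ^ (e ! j)))"

text \<open>Symbols: \<open>1\<close> is the unary digit for the number of variables, \<open>2\<close> opens a polynomial, \<open>3\<close> opens
  a monomial, \<open>4\<close>, \<open>5\<close>, \<open>6\<close> are the exponents \<open>0\<close>, \<open>1\<close>, \<open>2\<close>, and \<open>7\<close>, \<open>8\<close> the coefficients
  \<open>1\<close>, \<open>-1\<close>.\<close>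

definition enc_monomial :: "nat list \<times> 3 \<Rightarrow> nat list" where
  "enc_monomial m = 3 # map (\<lambda>d. 4 + d) (fst m) @ [if snd m = 1 then 7 else 8]"

definition enc_xpoly :: "xpoly \<Rightarrow> nat list" where
  "enc_xpoly p = 2 # concat (map enc_monomial p)"

definition sigma_problem :: "mat2 \<Rightarrow> (nat \<times> xpoly list) problem" where
  "sigma_problem \<alpha> =
     \<lparr> inputs = {(n, ps). \<forall>p\<in>set ps. expanded_poly n p},
       encode = (\<lambda>(n, ps). replicate n 1 @ concat (map enc_xpoly ps)),
       holds = (\<lambda>(n, ps). \<forall>a. (\<forall>j<n. a j \<in> {-1, 1}) \<longrightarrow>
                  (\<Sum>i<length ps. mat_power_Z3 \<alpha> (eval_xpoly n (ps ! i) a)) = 0) \<rparr>"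

section \<open>Restricted polynomial equivalence\<close>

datatype letter = Var nat | Const mat2

type_synonym rexpr = "letter list list"

definition restricted_expr :: "nat \<Rightarrow> rexpr \<Rightarrow> bool" where
  "restricted_expr n p \<longleftrightarrow>
     (\<forall>w\<in>set p. w \<noteq> [] \<and> (\<forall>l\<in>set w. case l of Var j \<Rightarrow> j < n | Const A \<Rightarrow> A \<in> GL2))"

fun eval_letter :: "(nat \<Rightarrow> mat2) \<Rightarrow> letter \<Rightarrow> mat2" where
  "eval_letter x (Var j) = x j"
| "eval_letter x (Const A) = A"

definition eval_word :: "(nat \<Rightarrow> mat2) \<Rightarrow> letter list \<Rightarrow> mat2" where
  "eval_word x w = foldr (\<lambda>l B. eval_letter x l ** B) w (mat 1)"

definition eval_rexpr :: "(nat \<Rightarrow> mat2) \<Rightarrow> rexpr \<Rightarrow> mat2" where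
  "eval_rexpr x p = (\<Sum>w\<leftarrow>p. eval_word x w)"

text \<open>Symbols: \<open>1\<close> is the unary digit for the number of variables and for indices of variables, \<open>2\<close>
  opens a word, \<open>3\<close> opens a variable; each of the 16 matrices has one symbol from \<open>4\<close> to \<open>19\<close>.\<close>

definition mat_code :: "mat2 \<Rightarrow> nat" where
  "mat_code A = 8 * of_bool (A $ 1 $ 1 = 1) + 4 * of_bool (A $ 1 $ 2 = 1)
     + 2 * of_bool (A $ 2 $ 1 = 1) + of_bool (A $ 2 $ 2 = 1)"

fun enc_letter :: "letter \<Rightarrow> nat list" where
  "enc_letter (Var j) = 3 # replicate j 1"
| "enc_letter (Const A) = [4 + mat_code A]"

definition enc_word :: "letter list \<Rightarrow> nat list" where
  "enc_word w = 2 # concat (map enc_letter w)"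

definition restricted_equivalence_problem :: "(nat \<times> rexpr) problem" where
  "restricted_equivalence_problem =
     \<lparr> inputs = {(n, p). restricted_expr n p},
       encode = (\<lambda>(n, p). replicate n 1 @ concat (map enc_word p)),
       holds = (\<lambda>(n, p). \<forall>x. (\<forall>j<n. x j \<in> GL2) \<longrightarrow> eval_rexpr x p = 0) \<rparr>"

section \<open>Sanity checks\<close>

lemma mat2_eq_iff:
  "A = B \<longleftrightarrow> A $ 1 $ 1 = B $ 1 $ 1 \<and> A $ 1 $ 2 = B $ 1 $ 2 \<and> A $ 2 $ 1 = B $ 2 $ 1 \<and> A $ 2 $ 2 = B $ 2 $ 2"
  for A B :: mat2
  by (auto simp: vec_eq_iff forall_2)

lemma primitive_alpha0: "primitive_F4 alpha0"
proof -
  have "mat 1 = mat_power alpha0 0" "alpha0 = mat_power alpha0 1"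
    by simp_all
  then show ?thesis
    unfolding primitive_F4_def F4_def by blast
qed

lemma alpha0_square: "mat_power alpha0 2 = vector [vector [1, 1], vector [1, 0]]"
  by (simp add: mat2_eq_iff alpha0_def matrix_matrix_mult_def mat_def sum_2 numeral_2_eq_2)

lemma alpha0_cube: "mat_power alpha0 3 = mat 1"
proof -
  have "mat_power alpha0 3 = alpha0 ** mat_power alpha0 2"
    by (simp add: eval_nat_numeral)
  then show ?thesis
    by (simp add: alpha0_square) (simp add: mat2_eq_iff alpha0_def matrix_matrix_mult_def mat_def sum_2)
qed

lemma alpha0_relation: "mat 1 + alpha0 = mat_power alpha0 2"
  unfolding alpha0_square by (simp add: mat2_eq_iff alpha0_def mat_def)

lemma card_F4: "card F4 = 4"
  unfolding F4_def alpha0_square by (simp add: mat2_eq_iff alpha0_def mat_def card_insert_if)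

lemma concat_map_inject:
  assumes "\<And>x. x \<in> set xs \<union> set ys \<Longrightarrow> \<exists>h t. f x = h # t \<and> H h \<and> (\<forall>s\<in>set t. \<not> H s)"
    and "inj_on f (set xs \<union> set ys)"
    and "concat (map f xs) = concat (map f ys)"
  shows "xs = ys"
  using assms
proof (induction xs arbitrary: ys)
  case Nil
  show ?case
  proof (cases ys)
    case (Cons y ys')
    then show ?thesis using Nil.prems(1)[of y] Nil.prems(3) by auto
  qed simp
next
  case (Cons x xs)
  obtain h t where x: "f x = h # t" "\<forall>s\<in>set t. \<not> H s"
    using Cons.prems(1)[of x] by auto
  then obtain y ys' where ys: "ys = y # ys'"
    using Cons.prems(3) by (cases ys) auto
  obtain h' t' where y: "f y = h' # t'" "\<forall>s\<in>set t'. \<not> H s"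
    using Cons.prems(1)[of y] ys by auto
  have hd: "concat (map f zs) = [] \<or> H (hd (concat (map f zs)))"
    if "set zs \<subseteq> set (x # xs) \<union> set ys" for zs
  proof (cases zs)
    case (Cons z zs')
    then show ?thesis using Cons.prems(1)[of z] that by auto
  qed simp
  have *: "takeWhile (\<lambda>s. \<not> H s) (u @ concat (map f zs)) = u"
    if "\<forall>s\<in>set u. \<not> H s" "set zs \<subseteq> set (x # xs) \<union> set ys" for u zs
  proof -
    have "takeWhile (\<lambda>s. \<not> H s) v = []" if "v = [] \<or> H (hd v)" for v
      using that by (cases v) auto
    then show ?thesis
      using that(1) hd[OF that(2)] by (simp add: takeWhile_append2)
  qed
  have eq: "h = h'" "t @ concat (map f xs) = t' @ concat (map f ys')"
    using Cons.prems(3) ys x y by auto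
  have "t = t'"
    using *[of t xs] *[of t' ys'] eq(2) x y ys by auto
  then have "f x = f y" "concat (map f xs) = concat (map f ys')"
    using eq x y by auto
  moreover have "xs = ys'"
  proof (rule Cons.IH)
    show "\<exists>h t. f z = h # t \<and> H h \<and> (\<forall>s\<in>set t. \<not> H s)" if "z \<in> set xs \<union> set ys'" for z
      using that ys by (intro Cons.prems(1)) auto
    show "inj_on f (set xs \<union> set ys')"
      using Cons.prems(2) by (rule inj_on_subset) (use ys in auto)
  qed fact
  moreover have "x = y"
    using inj_onD[OF Cons.prems(2) \<open>f x = f y\<close>] ys by simp
  ultimately show ?case
    using ys by simp
qed

lemma replicate_append_inject:
  assumes "replicate m (1::nat) @ u = replicate n 1 @ v"
    and "u = [] \<or> hd u \<noteq> 1" "v = [] \<or> hd v \<noteq> 1"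
  shows "m = n \<and> u = v"
  using assms
proof (induction m arbitrary: n)
  case 0
  then show ?case by (cases n) auto
next
  case (Suc m)
  then show ?case by (cases n) auto
qed

lemma Z3_cases: "c = 0 \<or> c = 1 \<or> c = -1" for c :: 3
  using exhaust_3[of c] by auto

lemma inj_sigma_encode: "inj_on (encode (sigma_problem \<alpha>)) (inputs (sigma_problem \<alpha>))"
proof -
  have mono: "m = m'"
    if "enc_monomial m = enc_monomial m'" "snd m \<noteq> 0" "snd m' \<noteq> 0" for m m'
    using that Z3_cases[of "snd m"] Z3_cases[of "snd m'"]
    by (auto simp: enc_monomial_def prod_eq_iff inj_def inj_map_eq_map split: if_splits)
  have xpoly: "p = p'"
    if "enc_xpoly p = enc_xpoly p'" "expanded_poly n p" "expanded_poly n p'" for p p' n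
  proof (rule concat_map_inject[where f = enc_monomial and H = "\<lambda>s. s = 3"])
    show "\<exists>h t. enc_monomial m = h # t \<and> h = 3 \<and> (\<forall>s\<in>set t. s \<noteq> 3)" if "m \<in> set p \<union> set p'" for m
      by (auto simp: enc_monomial_def)
    show "inj_on enc_monomial (set p \<union> set p')"
    proof (rule inj_onI)
      fix m m' assume *: "m \<in> set p \<union> set p'" "m' \<in> set p \<union> set p'" "enc_monomial m = enc_monomial m'"
      have "snd m \<noteq> 0" "snd m' \<noteq> 0"
        using that(2,3) *(1,2) by (auto simp: expanded_poly_def split_beta)
      then show "m = m'" using mono *(3) by blast
    qed
  qed (use that in \<open>simp add: enc_xpoly_def\<close>)
  have polys: "ps = ps'"
    if "concat (map enc_xpoly ps) = concat (map enc_xpoly ps')"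
      "\<forall>p\<in>set ps. expanded_poly n p" "\<forall>p\<in>set ps'. expanded_poly n p" for ps ps' n
  proof (rule concat_map_inject[where f = enc_xpoly and H = "\<lambda>s. s = 2"])
    show "\<exists>h t. enc_xpoly p = h # t \<and> h = 2 \<and> (\<forall>s\<in>set t. s \<noteq> 2)" if "p \<in> set ps \<union> set ps'" for p
      by (auto simp: enc_xpoly_def enc_monomial_def)
    show "inj_on enc_xpoly (set ps \<union> set ps')"
      using that xpoly unfolding inj_on_def by blast
  qed (use that in simp)
  have hd: "concat (map enc_xpoly ps) = [] \<or> hd (concat (map enc_xpoly ps)) \<noteq> 1" for ps
    by (cases ps) (auto simp: enc_xpoly_def)
  show ?thesis
    unfolding inj_on_def sigma_problem_def
  proof (clarsimp)
    fix n ps n' ps'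
    assume *: "\<forall>p\<in>set ps. expanded_poly n p" "\<forall>p\<in>set ps'. expanded_poly n' p"
      "replicate n (Suc 0) @ concat (map enc_xpoly ps) = replicate n' (Suc 0) @ concat (map enc_xpoly ps')"
    then have "n = n' \<and> concat (map enc_xpoly ps) = concat (map enc_xpoly ps')"
      by (intro replicate_append_inject hd) simp
    then show "n = n' \<and> ps = ps'"
      using polys * by blast
  qed
qed

lemma mat_code_inject: "mat_code A = mat_code B \<longleftrightarrow> A = B"
proof
  have bit: "x = y" if "(of_bool (x = 1) :: nat) = of_bool (y = 1)" for x y :: bit
    using that by (cases x; cases y) simp_all
  have nat: "a = a' \<and> b = b' \<and> c = c' \<and> d = d'"
    if "8 * a + 4 * b + 2 * c + d = 8 * a' + 4 * b' + 2 * c' + d'"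
      "a \<le> 1" "b \<le> 1" "c \<le> 1" "d \<le> 1" "a' \<le> 1" "b' \<le> 1" "c' \<le> 1" "d' \<le> 1"
    for a b c d a' b' c' d' :: nat
  proof -
    have "a = a'" using that by linarith
    moreover from this have "b = b'" using that by linarith
    moreover from calculation have "c = c'" using that by linarith
    ultimately show ?thesis using that by linarith
  qed
  have le: "of_bool Q \<le> (1::nat)" for Q
    by simp
  assume "mat_code A = mat_code B"
  from nat[OF this[unfolded mat_code_def] le le le le le le le le]
  show "A = B"
    unfolding mat2_eq_iff using bit by blast
qed simp

lemma inj_restricted_encode: "inj (encode restricted_equivalence_problem)"
proof -
  have letter: "l = l'" if "enc_letter l = enc_letter l'" for l l'
    using that by (cases l; cases l') (auto simp: mat_code_inject dest: arg_cong[of _ _ length])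
  have word: "w = w'" if "enc_word w = enc_word w'" for w w'
  proof (rule concat_map_inject[where f = enc_letter and H = "\<lambda>s. s \<ge> 3"])
    show "\<exists>h t. enc_letter l = h # t \<and> h \<ge> 3 \<and> (\<forall>s\<in>set t. \<not> s \<ge> 3)" for l
      by (cases l) auto
    show "inj_on enc_letter (set w \<union> set w')"
      using letter by (auto simp: inj_on_def)
  qed (use that in \<open>simp add: enc_word_def\<close>)
  have sep: "s \<noteq> 2" if "s \<in> set (enc_letter l)" for s l
    using that by (cases l) auto
  have words: "p = p'" if "concat (map enc_word p) = concat (map enc_word p')" for p p'
  proof (rule concat_map_inject[where f = enc_word and H = "\<lambda>s. s = 2"])
    show "\<exists>h t. enc_word w = h # t \<and> h = 2 \<and> (\<forall>s\<in>set t. s \<noteq> 2)" for w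
      using sep by (auto simp: enc_word_def)
    show "inj_on enc_word (set p \<union> set p')"
      using word by (auto simp: inj_on_def)
  qed (use that in simp)
  have hd: "concat (map enc_word p) = [] \<or> hd (concat (map enc_word p)) \<noteq> 1" for p
    by (cases p) (auto simp: enc_word_def)
  show ?thesis
    unfolding inj_def restricted_equivalence_problem_def
  proof (clarsimp)
    fix n p n' p'
    assume "replicate n (Suc 0) @ concat (map enc_word p) = replicate n' (Suc 0) @ concat (map enc_word p')"
    then have "n = n' \<and> concat (map enc_word p) = concat (map enc_word p')"
      by (intro replicate_append_inject hd) simp
    then show "n = n' \<and> p = p'"
      using words by blast
  qed
qed

end

theory Submission
  imports Defs
begin

text \<open>
  The group \<open>GL2\<close> is isomorphic to the symmetric group on three letters, and conjugation by
  \<open>A \<in> GL2\<close> sends \<open>\<alpha>\<close> to \<open>\<alpha>\<close> or to its inverse according to the sign of \<open>A\<close>. The cube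
  \<open>A\<^sup>3\<close> has the same sign as \<open>A\<close> and is its own inverse, so inverses can be written without
  leaving the language of words. Hence, if \<open>a\<^sub>j\<close> is the sign of \<open>x\<^sub>j\<close>, the power of \<open>\<alpha>\<close> with
  exponent \<open>c a\<^sub>i \<cdots> a\<^sub>k\<close> is the value of the palindrome
  \<open>x\<^sub>i\<^sup>3 \<cdots> x\<^sub>k\<^sup>3 \<alpha>\<^sup>c x\<^sub>k\<^sup>3 \<cdots> x\<^sub>i\<^sup>3\<close>; variables with even exponent drop out as \<open>a\<^sub>j\<^sup>2 = 1\<close>.
  The word of a polynomial is the product of the words of its monomials, and since every
  vector of signs is attained, the two problems have the same answer.

  A palindrome is produced by sweeping over the exponents of a monomial from left to right and
  back, while the index of the current variable is kept in unary on a work tape.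
\<close>

section \<open>The words of the reduction\<close>

definition cube :: "nat \<Rightarrow> letter list" where
  "cube j = replicate 3 (Var j)"

lemma enc_cube: "concat (map enc_letter (cube j)) =
    3 # replicate j 1 @ 3 # replicate j 1 @ 3 # replicate j 1"
  by (simp add: cube_def eval_nat_numeral)

definition sign_word :: "nat list \<Rightarrow> letter list" where
  "sign_word e = concat (map (\<lambda>j. if e ! j = 1 then cube j else []) [0..<length e])"

lemma sign_word_Nil [simp]: "sign_word [] = []"
  by (simp add: sign_word_def)

lemma sign_word_snoc: "sign_word (e @ [d]) = sign_word e @ (if d = 1 then cube (length e) else [])"
  by (auto simp: sign_word_def nth_append intro!: arg_cong[of _ _ concat])

text \<open>The nonzero coefficients modulo 3 are 1 and -1, and \<open>\<alpha> ** \<alpha>\<close>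
  is the inverse of a primitive \<alpha>, so the middle letter is the power of \<alpha> with the
  coefficient as exponent.\<close>

definition monomial_word :: "mat2 \<Rightarrow> nat list \<times> 3 \<Rightarrow> letter list" where
  "monomial_word \<alpha> m = sign_word (fst m) @ Const (if snd m = 1 then \<alpha> else \<alpha> ** \<alpha>) # rev (sign_word (fst m))"

text \<open>The leading identity matrix keeps the word of the zero polynomial nonempty.\<close>

definition xpoly_word :: "mat2 \<Rightarrow> xpoly \<Rightarrow> letter list" where
  "xpoly_word \<alpha> p = Const (mat 1) # concat (map (monomial_word \<alpha>) p)"

definition reduction :: "mat2 \<Rightarrow> nat \<times> xpoly list \<Rightarrow> nat \<times> rexpr" where
  "reduction \<alpha> = (\<lambda>(n, ps). (n, map (xpoly_word \<alpha>) ps))"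

section \<open>Signs of invertible matrices\<close>

text \<open>Together with \<open>mat2_mult_nth\<close> this turns claims about one matrix into
  conditions on four bits, which a case distinction settles.\<close>

lemma GL2_iff: "A \<in> GL2 \<longleftrightarrow> A $ 1 $ 1 * A $ 2 $ 2 \<noteq> A $ 1 $ 2 * A $ 2 $ 1"
  by (simp add: GL2_def invertible_det_nz det_2)

lemma mat2_mult_nth:
  "(A ** B) $ i $ k = A $ i $ 1 * B $ 1 $ k + A $ i $ 2 * B $ 2 $ k" for A B :: mat2
  by (simp add: matrix_matrix_mult_def sum_2)

lemma alpha0_nth: "alpha0 $ 1 $ 1 = 0" "alpha0 $ 1 $ 2 = 1" "alpha0 $ 2 $ 1 = 1" "alpha0 $ 2 $ 2 = 1"
  by (simp_all add: alpha0_def)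

lemma mat_1_nth: "(mat 1 :: mat2) $ 1 $ 1 = 1" "(mat 1 :: mat2) $ 1 $ 2 = 0"
    "(mat 1 :: mat2) $ 2 $ 1 = 0" "(mat 1 :: mat2) $ 2 $ 2 = 1"
  by (simp_all add: mat_def)

text \<open>The powers of 0 are 0 and the identity, those of the identity only the identity; neither
  generates \<open>alpha0\<close>.\<close>

lemma primitive_F4_cases:
  assumes "primitive_F4 \<alpha>"
  shows "\<alpha> = alpha0 \<or> \<alpha> = alpha0 ** alpha0"
proof -
  have ne: "alpha0 \<noteq> mat 1" "alpha0 \<noteq> 0"
    unfolding mat2_eq_iff alpha0_nth mat_1_nth by simp_all
  then obtain m where m: "alpha0 = mat_power \<alpha> m"
    using assms unfolding primitive_F4_def F4_def by blast
  have "mat_power (mat 1) k = mat 1" for k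
    by (induction k) simp_all
  moreover have "mat_power 0 k = mat 1 \<or> mat_power 0 k = 0" for k
    by (cases k) simp_all
  ultimately have "\<alpha> \<noteq> mat 1" "\<alpha> \<noteq> 0"
    using m ne by metis+
  moreover have "\<alpha> \<in> {0, alpha0, alpha0 ** alpha0, mat 1}"
    using assms by (simp add: primitive_F4_def F4_def numeral_2_eq_2)
  ultimately show ?thesis
    by blast
qed

section \<open>Powers with exponents modulo 3\<close>

lemma mat_power_Z3_values:
  "mat_power_Z3 A 0 = mat 1" "mat_power_Z3 A 1 = A" "mat_power_Z3 A (-1) = A ** A"
proof -
  have "(LEAST m. of_nat m = (0::3)) = 0"
    by (rule Least_equality) auto
  then show "mat_power_Z3 A 0 = mat 1"
    by (simp add: mat_power_Z3_def)
  have "(LEAST m. of_nat m = (1::3)) = 1"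
    by (rule Least_equality) (auto simp: Suc_le_eq intro: Nat.gr0I)
  then show "mat_power_Z3 A 1 = A"
    by (simp add: mat_power_Z3_def)
  have "(LEAST m. of_nat m = (-1::3)) = 2"
  proof (rule Least_equality)
    fix m assume m: "of_nat m = (-1::3)"
    have "(0::3) \<noteq> -1" "(1::3) \<noteq> -1"
      by simp_all
    with m have "m \<noteq> 0" "m \<noteq> 1"
      by (metis of_nat_0, metis of_nat_1)
    then show "2 \<le> m" by simp
  qed simp
  then show "mat_power_Z3 A (-1) = A ** A"
    by (simp add: mat_power_Z3_def numeral_2_eq_2)
qed

lemma primitive_F4_cube:
  assumes "primitive_F4 \<alpha>"
  shows "\<alpha> ** (\<alpha> ** \<alpha>) = mat 1"
proof -
  have "alpha0 ** (alpha0 ** alpha0) = mat 1"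
    "alpha0 ** alpha0 ** ((alpha0 ** alpha0) ** (alpha0 ** alpha0)) = mat 1"
    unfolding mat2_eq_iff mat2_mult_nth alpha0_nth mat_1_nth by simp_all
  then show ?thesis
    using primitive_F4_cases[OF assms] by metis
qed

lemma mat_power_Z3_add:
  assumes "primitive_F4 \<alpha>"
  shows "mat_power_Z3 \<alpha> (s + t) = mat_power_Z3 \<alpha> s ** mat_power_Z3 \<alpha> t"
proof -
  \<comment> \<open>The sums are brought back to 1 and -1 so that \<open>mat_power_Z3_values\<close>
    applies; simp rules that would turn them into other numerals are deleted below.\<close>
  have two: "(1 + 1 :: 3) = -1" "(-1 - 1 :: 3) = 1" by simp_all
  have *: "\<alpha> ** \<alpha> ** \<alpha> = mat 1"
    using primitive_F4_cube[OF assms] by (simp add: matrix_mul_assoc)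
  show ?thesis
    using Z3_cases[of s] Z3_cases[of t] *
    by (elim disjE) (simp_all add: mat_power_Z3_values two matrix_mul_assoc del: one_add_one diff_numeral_special)
qed

text \<open>On \<open>GL2\<close> this is the sign of the permutation of the three nonzero vectors,
  since the centralizer of \<open>alpha0\<close> is the subgroup of order 3. The value is taken
  modulo 3 so that it can multiply exponents.\<close>

definition mat_sign :: "mat2 \<Rightarrow> 3" where
  "mat_sign A = (if A ** alpha0 = alpha0 ** A then 1 else -1)"

lemma mat_sign_even:
  assumes "A \<in> GL2" "mat_sign A = 1"
  shows "A ** A ** A = mat 1"
proof -
  have "A ** alpha0 = alpha0 ** A"
    using assms(2) by (simp add: mat_sign_def split: if_splits)
  with assms(1) show ?thesis
    unfolding GL2_iff mat2_eq_iff mat2_mult_nth alpha0_nth mat_1_nth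
    by (cases "A $ 1 $ 1"; cases "A $ 1 $ 2"; cases "A $ 2 $ 1"; cases "A $ 2 $ 2") simp_all
qed

text \<open>Odd elements are transpositions: each is its own inverse, and conjugation by it swaps
  the two 3-cycles.\<close>

lemma mat_sign_odd:
  assumes "A \<in> GL2" "mat_sign A \<noteq> 1"
  shows "A ** A = mat 1" "A ** alpha0 ** A = alpha0 ** alpha0" "A ** (alpha0 ** alpha0) ** A = alpha0"
proof -
  have "A ** alpha0 \<noteq> alpha0 ** A"
    using assms(2) by (auto simp: mat_sign_def)
  with assms(1) show "A ** A = mat 1" "A ** alpha0 ** A = alpha0 ** alpha0"
      "A ** (alpha0 ** alpha0) ** A = alpha0"
    unfolding GL2_iff mat2_eq_iff mat2_mult_nth alpha0_nth mat_1_nth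
    by (cases "A $ 1 $ 1"; cases "A $ 1 $ 2"; cases "A $ 2 $ 1"; cases "A $ 2 $ 2"; simp)+
qed

text \<open>The cube of an even matrix is the identity, that of an odd one is the matrix itself,
  which inverts powers of \<alpha>. So one expression covers both signs.\<close>

lemma mat_power_Z3_cube_conj:
  assumes "primitive_F4 \<alpha>" "A \<in> GL2"
  shows "(A ** A ** A) ** mat_power_Z3 \<alpha> t ** (A ** A ** A) = mat_power_Z3 \<alpha> (mat_sign A * t)"
proof (cases "mat_sign A = 1")
  case True
  then show ?thesis
    using mat_sign_even[OF assms(2)] by simp
next
  case False
  note A = mat_sign_odd[OF assms(2) False]
  \<comment> \<open>Squaring swaps the two primitive elements, so the rules for
    \<open>alpha0\<close> carry over to either choice of \<alpha>.\<close>
  have "alpha0 ** alpha0 ** (alpha0 ** alpha0) = alpha0"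
    unfolding mat2_eq_iff mat2_mult_nth alpha0_nth by simp
  then have "A ** \<alpha> ** A = \<alpha> ** \<alpha>" "A ** (\<alpha> ** \<alpha>) ** A = \<alpha>"
    using primitive_F4_cases[OF assms(1)] A by auto
  moreover have "mat_sign A = -1"
    using False by (simp add: mat_sign_def split: if_splits)
  ultimately show ?thesis
    using Z3_cases[of t] A(1) by (auto simp: mat_power_Z3_values)
qed

section \<open>Values of the words\<close>

lemma eval_word_append: "eval_word x (u @ v) = eval_word x u ** eval_word x v"
  by (induction u) (simp_all add: eval_word_def matrix_mul_assoc)

lemma eval_word_Nil: "eval_word x [] = mat 1"
  by (simp add: eval_word_def)

lemma eval_word_Const: "eval_word x [Const A] = A"
  by (simp add: eval_word_def)

lemma eval_word_cube: "eval_word x (cube j) = x j ** x j ** x j"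
  by (simp add: eval_word_def cube_def eval_nat_numeral matrix_mul_assoc)

lemma rev_cube: "rev (cube j) = cube j"
  by (simp add: cube_def)

text \<open>The last variable is innermost and acts on the power first. The induction therefore
  removes it from the end, with \<open>t\<close> arbitrary because the remaining variables see the
  changed exponent.\<close>

lemma eval_sign_word_conj:
  assumes "primitive_F4 \<alpha>" "\<forall>j<length e. x j \<in> GL2" "set e \<subseteq> {0, 1, 2}"
  shows "eval_word x (sign_word e) ** mat_power_Z3 \<alpha> t ** eval_word x (rev (sign_word e)) =
    mat_power_Z3 \<alpha> (t * (\<Prod>j<length e. mat_sign (x j) ^ (e ! j)))"
  using assms(2,3)
proof (induction e arbitrary: t rule: rev_induct)
  case Nil
  then show ?case by (simp add: eval_word_Nil)
next
  case (snoc d e)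
  let ?s = "mat_sign (x (length e))"
  let ?y = "if d = 1 then cube (length e) else []"
  have y: "eval_word x ?y ** mat_power_Z3 \<alpha> t ** eval_word x (rev ?y) = mat_power_Z3 \<alpha> (t * ?s ^ d)"
  proof (cases "d = 1")
    case True
    then show ?thesis
      using mat_power_Z3_cube_conj[OF assms(1), of "x (length e)" t] snoc.prems(1)
      by (simp add: eval_word_cube rev_cube mult.commute)
  next
    case False
    \<comment> \<open>The exponent is 0 or 2, and the square of a sign is 1.\<close>
    have "?s ^ d = 1"
      using False snoc.prems(2) by (auto simp: mat_sign_def)
    then show ?thesis
      using False by (simp add: eval_word_Nil)
  qed
  have "eval_word x (sign_word (e @ [d])) ** mat_power_Z3 \<alpha> t ** eval_word x (rev (sign_word (e @ [d])))
     = eval_word x (sign_word e) ** (eval_word x ?y ** mat_power_Z3 \<alpha> t ** eval_word x (rev ?y))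
         ** eval_word x (rev (sign_word e))"
    by (simp only: sign_word_snoc rev_append eval_word_append matrix_mul_assoc)
  also have "\<dots> = mat_power_Z3 \<alpha> (t * ?s ^ d * (\<Prod>j<length e. mat_sign (x j) ^ (e ! j)))"
    unfolding y using snoc.prems by (intro snoc.IH) auto
  also have "t * ?s ^ d * (\<Prod>j<length e. mat_sign (x j) ^ (e ! j)) =
      t * (\<Prod>j<length (e @ [d]). mat_sign (x j) ^ ((e @ [d]) ! j))"
    by (simp add: nth_append mult_ac)
  finally show ?case .
qed

text \<open>By \<open>mat_power_Z3_add\<close>, concatenating the words of monomials adds their
  exponents.\<close>

lemma eval_xpoly_word:
  assumes "primitive_F4 \<alpha>" "\<forall>j<n. x j \<in> GL2" "expanded_poly n p"
  shows "eval_word x (xpoly_word \<alpha> p) = mat_power_Z3 \<alpha> (eval_xpoly n p (\<lambda>j. mat_sign (x j)))"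
proof -
  have "eval_word x (concat (map (monomial_word \<alpha>) p)) =
      mat_power_Z3 \<alpha> (eval_xpoly n p (\<lambda>j. mat_sign (x j)))"
    using assms(3)
  proof (induction p)
    case Nil
    then show ?case by (simp add: eval_word_Nil eval_xpoly_def mat_power_Z3_values)
  next
    case (Cons m p)
    obtain e c where m: "m = (e, c)" by force
    have e: "length e = n" "set e \<subseteq> {0, 1, 2}" "c \<noteq> 0" and p: "expanded_poly n p"
      using Cons.prems by (auto simp: expanded_poly_def m)
    have c: "(if c = 1 then \<alpha> else \<alpha> ** \<alpha>) = mat_power_Z3 \<alpha> c"
      using Z3_cases[of c] e(3) by (auto simp: mat_power_Z3_values)
    have "eval_word x (monomial_word \<alpha> m) =
        eval_word x (sign_word e @ [Const (mat_power_Z3 \<alpha> c)] @ rev (sign_word e))"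
      by (simp add: monomial_word_def m c)
    also have "\<dots> = mat_power_Z3 \<alpha> (c * (\<Prod>j<n. mat_sign (x j) ^ (e ! j)))"
      using eval_sign_word_conj[OF assms(1), of e x c] e(1,2) assms(2)
      by (simp only: eval_word_append eval_word_Const matrix_mul_assoc)
    finally show ?case
      using Cons.IH[OF p]
      by (simp add: eval_word_append eval_xpoly_def m mat_power_Z3_add[OF assms(1)])
  qed
  then show ?thesis
    using eval_word_append[of x "[Const (mat 1)]"] by (simp add: xpoly_word_def eval_word_Const)
qed

section \<open>Correctness of the reduction\<close>

lemma mat_sign_surj:
  assumes "s \<in> {-1, 1}"
  obtains A where "A \<in> GL2" "mat_sign A = s"
proof (cases "s = 1")
  case True
  have "mat 1 \<in> GL2" "mat_sign (mat 1) = 1"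
    by (simp_all add: GL2_iff mat_1_nth mat_sign_def)
  then show ?thesis
    using True that by blast
next
  case False
  \<comment> \<open>Swapping the two basis vectors is a transposition, hence odd.\<close>
  define T :: mat2 where "T = vector [vector [0, 1], vector [1, 0]]"
  have "T \<in> GL2" "mat_sign T = -1"
    by (simp_all add: GL2_iff T_def mat_sign_def mat2_eq_iff mat2_mult_nth alpha0_def)
  then show ?thesis
    using False assms that by blast
qed

lemma reduction_correct:
  assumes "primitive_F4 \<alpha>" "e \<in> inputs (sigma_problem \<alpha>)"
  shows "holds (sigma_problem \<alpha>) e \<longleftrightarrow> holds restricted_equivalence_problem (reduction \<alpha> e)"
proof -
  obtain n ps where e: "e = (n, ps)" by force
  have ps: "expanded_poly n p" if "p \<in> set ps" for p
    using assms(2) that by (simp add: e sigma_problem_def)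
  define S where "S a = (\<Sum>i<length ps. mat_power_Z3 \<alpha> (eval_xpoly n (ps ! i) a))" for a
  \<comment> \<open>The matrices chosen below realize the given signs only for indices below
    \<open>n\<close>; elsewhere the two assignments may differ.\<close>
  have S_cong: "S a = S b" if "\<forall>j<n. a j = b j" for a b
  proof -
    have "(\<Prod>j<n. a j ^ (e ! j)) = (\<Prod>j<n. b j ^ (e ! j))" for e
      using that by (intro prod.cong) auto
    then show ?thesis
      by (simp add: S_def eval_xpoly_def)
  qed
  have eval: "eval_rexpr x (map (xpoly_word \<alpha>) ps) = S (\<lambda>j. mat_sign (x j))" if "\<forall>j<n. x j \<in> GL2" for x
  proof -
    have "eval_rexpr x (map (xpoly_word \<alpha>) ps) =
        (\<Sum>p\<leftarrow>ps. mat_power_Z3 \<alpha> (eval_xpoly n p (\<lambda>j. mat_sign (x j))))"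
      using eval_xpoly_word[OF assms(1) that ps] by (simp add: eval_rexpr_def o_def cong: map_cong)
    then show ?thesis
      by (simp add: S_def sum_list_sum_nth atLeast0LessThan)
  qed
  have sign: "mat_sign A \<in> {-1, 1}" for A
    by (simp add: mat_sign_def)
  have "(\<forall>a. (\<forall>j<n. a j \<in> {-1, 1}) \<longrightarrow> S a = 0) \<longleftrightarrow>
      (\<forall>x. (\<forall>j<n. x j \<in> GL2) \<longrightarrow> S (\<lambda>j. mat_sign (x j)) = 0)" (is "?L \<longleftrightarrow> ?R")
  proof
    show ?R if L: ?L
    proof (intro allI impI)
      show "S (\<lambda>j. mat_sign (x j)) = 0" for x
        using L[rule_format, of "\<lambda>j. mat_sign (x j)"] sign by blast
    qed
    show ?L if R: ?R
    proof (intro allI impI)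
      fix a :: "nat \<Rightarrow> 3" assume a: "\<forall>j<n. a j \<in> {-1, 1}"
      have "\<forall>j\<in>{..<n}. \<exists>A. A \<in> GL2 \<and> mat_sign A = a j"
      proof
        fix j assume "j \<in> {..<n}"
        then have "a j \<in> {-1, 1}"
          using a by blast
        then show "\<exists>A. A \<in> GL2 \<and> mat_sign A = a j"
          by (rule mat_sign_surj) blast
      qed
      then obtain x where x: "\<forall>j\<in>{..<n}. x j \<in> GL2 \<and> mat_sign (x j) = a j"
        by (rule bchoice[THEN exE])
      then have "S (\<lambda>j. mat_sign (x j)) = 0"
        using R[rule_format, of x] by simp
      then show "S a = 0"
        using S_cong[of "\<lambda>j. mat_sign (x j)" a] x by simp
    qed
  qed
  moreover have "holds (sigma_problem \<alpha>) e \<longleftrightarrow> (\<forall>a. (\<forall>j<n. a j \<in> {-1, 1}) \<longrightarrow> S a = 0)"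
    by (simp add: e sigma_problem_def S_def)
  moreover have "holds restricted_equivalence_problem (reduction \<alpha> e) \<longleftrightarrow>
      (\<forall>x. (\<forall>j<n. x j \<in> GL2) \<longrightarrow> S (\<lambda>j. mat_sign (x j)) = 0)"
    unfolding e restricted_equivalence_problem_def reduction_def using eval by auto
  ultimately show ?thesis
    by simp
qed

lemma reduction_input:
  assumes "primitive_F4 \<alpha>" "e \<in> inputs (sigma_problem \<alpha>)"
  shows "reduction \<alpha> e \<in> inputs restricted_equivalence_problem"
proof -
  \<comment> \<open>The cube equation makes \<alpha> and its square inverse to each other.\<close>
  have "\<alpha> ** (\<alpha> ** \<alpha>) = mat 1" "(\<alpha> ** \<alpha>) ** \<alpha> = mat 1"
    using primitive_F4_cube[OF assms(1)] by (simp_all add: matrix_mul_assoc)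
  then have "invertible \<alpha>" "invertible (\<alpha> ** \<alpha>)"
    unfolding invertible_def by blast+
  then have GL2: "\<alpha> \<in> GL2" "\<alpha> ** \<alpha> \<in> GL2" "mat 1 \<in> GL2"
    by (auto simp: GL2_def invertible_def)
  have sign_word: "\<exists>j<length e. l = Var j" if "l \<in> set (sign_word e)" for l e
    using that by (auto simp: sign_word_def cube_def split: if_splits)
  have "w \<noteq> [] \<and> (\<forall>l\<in>set w. case l of Var j \<Rightarrow> j < n | Const A \<Rightarrow> A \<in> GL2)"
    if "expanded_poly n p" and w: "w = xpoly_word \<alpha> p" for n p w
  proof (intro conjI ballI)
    show "w \<noteq> []"
      by (simp add: w xpoly_word_def)
    fix l assume "l \<in> set w"
    then consider "l = Const (mat 1)" | m where "m \<in> set p" "l \<in> set (monomial_word \<alpha> m)"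
      by (auto simp: w xpoly_word_def)
    then show "case l of Var j \<Rightarrow> j < n | Const A \<Rightarrow> A \<in> GL2"
    proof cases
      case 2
      then have "length (fst m) = n"
        using that(1) by (auto simp: expanded_poly_def)
      then show ?thesis
        using 2(2) sign_word[of l "fst m"] GL2 by (auto simp: monomial_word_def)
    qed (use GL2 in simp)
  qed
  then have "restricted_expr n (map (xpoly_word \<alpha>) ps)" if "\<forall>p\<in>set ps. expanded_poly n p" for n ps
    using that unfolding restricted_expr_def by fastforce
  then show ?thesis
    using assms(2)
    by (auto simp: sigma_problem_def restricted_equivalence_problem_def reduction_def)
qed

section \<open>The Turing machine\<close>

text \<open>Tells which of the three occurrences of a variable in its cube is being written.\<close>

datatype copy = First | Second | Third

text \<open>
  \<open>Main\<close> reads the symbol that opens the next item. \<open>Fwd\<close> and \<open>Bwd\<close> sweep over the exponents of a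
  monomial, \<open>Dec\<close> completes the decrement of the counter in the backward sweep, and \<open>Skip\<close> moves
  to the end of the monomial. \<open>Emit\<close> writes a variable while the head of the counter runs to the
  left end, \<open>Rewind\<close> brings it back; their flag is \<open>True\<close> in the forward sweep.
\<close>

datatype st = Main | Halt | Open | Fwd | Bwd | Dec | Skip | Emit bool copy | Rewind bool copy

fun copy_code :: "copy \<Rightarrow> nat" where
  "copy_code First = 0" | "copy_code Second = 1" | "copy_code Third = 2"

text \<open>The machine model prescribes 0 for the start and 1 for the stop; states with a copy take
  blocks of three codes from 7 to 18.\<close>

fun st_code :: "st \<Rightarrow> nat" where
  "st_code Main = 0"
| "st_code Halt = 1"
| "st_code Open = 2"
| "st_code Fwd = 3"
| "st_code Bwd = 4"
| "st_code Dec = 5"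
| "st_code Skip = 6"
| "st_code (Emit d k) = (if d then 7 else 13) + copy_code k"
| "st_code (Rewind d k) = (if d then 10 else 16) + copy_code k"

lemma copy_code_less: "copy_code k < 3"
  by (cases k) auto

lemma st_code_less: "st_code q < 19"
proof (cases q)
  case (Emit d k)
  then show ?thesis using copy_code_less[of k] by simp
next
  case (Rewind d k)
  then show ?thesis using copy_code_less[of k] by simp
qed simp_all

definition st_decode :: "nat \<Rightarrow> st" where
  "st_decode n =
     [Main, Halt, Open, Fwd, Bwd, Dec, Skip,
      Emit True First, Emit True Second, Emit True Third,
      Rewind True First, Rewind True Second, Rewind True Third,
      Emit False First, Emit False Second, Emit False Third,
      Rewind False First, Rewind False Second, Rewind False Third] ! n"

lemma st_decode_code: "st_decode (st_code q) = q"
proof (cases q)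
  case (Emit d k)
  then show ?thesis by (cases d; cases k) (simp_all add: st_decode_def)
next
  case (Rewind d k)
  then show ?thesis by (cases d; cases k) (simp_all add: st_decode_def)
qed (simp_all add: st_decode_def)

text \<open>The arguments are the symbols on the input and on the counter. The input is never
  overwritten, and the optional last component is appended to the output.\<close>

fun transition :: "mat2 \<Rightarrow> st \<Rightarrow> nat \<Rightarrow> nat \<Rightarrow> st \<times> move \<times> (nat \<times> move) \<times> nat option" where
  "transition \<alpha> Main a b =
     (if a = 1 then (Main, Right, (b, Stay), Some 1)
      else if a = 2 then (Open, Stay, (b, Stay), Some 2)
      else if a = 3 then (Fwd, Right, (b, Stay), None)
      else (Halt, Stay, (b, Stay), None))"
| "transition \<alpha> Halt a b = (Halt, Stay, (b, Stay), None)"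
| "transition \<alpha> Open a b = (Main, Right, (b, Stay), Some (4 + mat_code (mat 1)))"
| "transition \<alpha> Fwd a b =
     (if a = 5 then (Emit True First, Stay, (b, Left), Some 3)
      else if a = 7 then (Bwd, Left, (b, Stay), Some (4 + mat_code \<alpha>))
      else if a = 8 then (Bwd, Left, (b, Stay), Some (4 + mat_code (\<alpha> ** \<alpha>)))
      else (Fwd, Right, (1, Right), None))"
| "transition \<alpha> Bwd a b =
     (if a = 3 then (Skip, Right, (b, Stay), None) else (Dec, Stay, (b, Left), None))"
| "transition \<alpha> Dec a b =
     (if a = 5 then (Emit False First, Stay, (0, Left), Some 3) else (Bwd, Left, (0, Stay), None))"
| "transition \<alpha> Skip a b =
     (if a = 7 \<or> a = 8 then (Main, Right, (b, Stay), None) else (Skip, Right, (b, Stay), None))"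
| "transition \<alpha> (Emit d k) a b =
     (if b = 1 then (Emit d k, Stay, (b, Left), Some 1) else (Rewind d k, Stay, (b, Right), None))"
| "transition \<alpha> (Rewind d k) a b =
     (if b = 1 then (Rewind d k, Stay, (b, Right), None)
      else case k of
        First \<Rightarrow> (Emit d Second, Stay, (b, Left), Some 3)
      | Second \<Rightarrow> (Emit d Third, Stay, (b, Left), Some 3)
      | Third \<Rightarrow> if d then (Fwd, Right, (1, Right), None) else (Bwd, Left, (b, Stay), None))"

text \<open>The tapes are input, counter and output. The symbols are the blank and the codes 1 to
  19, the last ones for matrices. The output head moves only after appending a symbol.\<close>

definition machine :: "mat2 \<Rightarrow> tm" where
  "machine \<alpha> = \<lparr> tapes = 3, symbols = 20, states = 19,
     delta = (\<lambda>q rs. case transition \<alpha> (st_decode q) (rs ! 0) (rs ! 1) of (q', m, sm, y) \<Rightarrow>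
       (st_code q', [(rs ! 0, m), sm, case y of None \<Rightarrow> (rs ! 2, Stay) | Some s \<Rightarrow> (s, Right)])) \<rparr>"

section \<open>Well-formedness of the machine\<close>

lemma mat_code_less: "mat_code A < 16"
  by (simp add: mat_code_def of_bool_def)

lemma transition_bounded:
  assumes "transition \<alpha> q a b = (q', m, (s, m'), y)" "b < 20"
  shows "s < 20 \<and> (\<forall>z. y = Some z \<longrightarrow> z < 20)"
  using assms mat_code_less[of "mat 1"] mat_code_less[of \<alpha>] mat_code_less[of "\<alpha> ** \<alpha>"]
  by (cases q) (auto split: if_splits copy.splits)

lemma wf_machine: "wf_tm (machine \<alpha>)"
proof -
  have "case delta (machine \<alpha>) q rs of (q', acts) \<Rightarrow>
      q' < 19 \<and> length acts = 3 \<and> fst ` set acts \<subseteq> {..<20}"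
    if rs: "length rs = 3" "set rs \<subseteq> {..<20}" for q rs
  proof -
    have less: "rs ! 0 < 20" "rs ! 1 < 20" "rs ! 2 < 20"
      using rs by (auto simp: subset_iff)
    obtain q' m s m' y where t: "transition \<alpha> (st_decode q) (rs ! 0) (rs ! 1) = (q', m, (s, m'), y)"
      by (metis prod.collapse)
    show ?thesis
      using transition_bounded[OF t less(2)] less t st_code_less
      by (auto simp: machine_def split: option.splits)
  qed
  then show ?thesis
    by (auto simp: wf_tm_def machine_def)
qed

section \<open>Configurations and runs of bounded length\<close>

definition unary :: "nat \<Rightarrow> int \<Rightarrow> nat" where
  "unary j h = (if 0 \<le> h \<and> h < int j then 1 else 0)"

text \<open>The counter fills the cells 0 to \<open>j - 1\<close>, so the blanks at -1 and
  \<open>j\<close> mark its ends. The output head stands on the first blank after the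
  output.\<close>

definition cfg :: "nat list \<Rightarrow> st \<Rightarrow> int \<Rightarrow> nat \<Rightarrow> int \<Rightarrow> nat list \<Rightarrow> config" where
  "cfg w q i j h v = (st_code q,
     [(tape_content w, i), (unary j, h), (tape_content v, int (length v))])"

lemma tape_content_end: "tape_content v (int (length v)) = 0"
  by (simp add: tape_content_def)

lemma tape_content_snoc: "(tape_content v)(int (length v) := s) = tape_content (v @ [s])"
  by (auto simp: tape_content_def fun_eq_iff nth_append)

lemma tape_content_append: "tape_content (u @ x # v) (int (length u)) = x"
  by (simp add: tape_content_def)

lemma step_cfg:
  assumes "transition \<alpha> q (tape_content w i) (unary j h) = (q', m, (s, m'), y)"
    and "q \<noteq> Halt"
    and "(unary j)(h := s) = unary j'"
  shows "tm_step (machine \<alpha>) (cfg w q i j h v) =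
    cfg w q' (move_head m i) j' (move_head m' h) (v @ (case y of None \<Rightarrow> [] | Some z \<Rightarrow> [z]))"
proof -
  have "st_code q \<noteq> 1"
    using \<open>q \<noteq> Halt\<close> st_decode_code by (metis st_code.simps(2))
  \<comment> \<open>When nothing is appended, the third head rewrites the blank that it
    reads.\<close>
  moreover have "(tape_content v)(int (length v) := 0) = tape_content v"
    by (auto simp: tape_content_def)
  ultimately show ?thesis
    using assms tape_content_snoc
    by (auto simp: cfg_def machine_def st_decode_code tape_content_end split: option.splits)
qed

text \<open>An upper bound on the number of steps lets branches of different lengths share one
  estimate.\<close>

definition reach :: "mat2 \<Rightarrow> nat \<Rightarrow> config \<Rightarrow> config \<Rightarrow> bool" where
  "reach \<alpha> t c c' \<longleftrightarrow> (\<exists>s\<le>t. (tm_step (machine \<alpha>) ^^ s) c = c')"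

lemma reach_refl: "reach \<alpha> 0 c c"
  by (simp add: reach_def)

lemma reach_mono: "reach \<alpha> t c c' \<Longrightarrow> t \<le> t' \<Longrightarrow> reach \<alpha> t' c c'"
  unfolding reach_def using le_trans by blast

lemma reach_trans:
  assumes "reach \<alpha> t c c'" "reach \<alpha> t' c' c''"
  shows "reach \<alpha> (t + t') c c''"
proof -
  obtain s s' where s: "s \<le> t" "s' \<le> t'" "(tm_step (machine \<alpha>) ^^ s) c = c'"
    "(tm_step (machine \<alpha>) ^^ s') c' = c''"
    using assms by (auto simp: reach_def)
  then have "(tm_step (machine \<alpha>) ^^ (s' + s)) c = c''"
    by (simp add: funpow_add)
  then show ?thesis
    using s by (auto simp: reach_def intro!: exI[of _ "s' + s"])
qed

lemma reach_step:
  assumes "transition \<alpha> q (tape_content w i) (unary j h) = (q', m, (s, m'), y)"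
    and "q \<noteq> Halt"
    and "(unary j)(h := s) = unary j'"
    and "i' = move_head m i" "h' = move_head m' h" "v' = v @ (case y of None \<Rightarrow> [] | Some z \<Rightarrow> [z])"
  shows "reach \<alpha> 1 (cfg w q i j h v) (cfg w q' i' j' h' v')"
  using step_cfg[OF assms(1-3), of v] assms(4-)
  by (auto simp: reach_def intro!: exI[of _ "Suc 0"])

section \<open>Writing the cube of a variable\<close>

lemma reach_emit:
  "k \<le> j \<Longrightarrow> reach \<alpha> k (cfg w (Emit d c) i j (int k - 1) v) (cfg w (Emit d c) i j (-1) (v @ replicate k 1))"
proof (induction k arbitrary: v)
  case 0
  then show ?case by (simp add: reach_refl)
next
  case (Suc k)
  have "reach \<alpha> 1 (cfg w (Emit d c) i j (int (Suc k) - 1) v) (cfg w (Emit d c) i j (int k - 1) (v @ [1]))"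
    using Suc.prems by (intro reach_step) (auto simp: unary_def)
  from reach_trans[OF this Suc.IH] Suc.prems show ?case
    by simp
qed

lemma reach_rewind:
  "k \<le> j \<Longrightarrow> reach \<alpha> k (cfg w (Rewind d c) i j (int j - int k) v) (cfg w (Rewind d c) i j (int j) v)"
proof (induction k)
  case 0
  then show ?case by (simp add: reach_refl)
next
  case (Suc k)
  have "reach \<alpha> 1 (cfg w (Rewind d c) i j (int j - int (Suc k)) v) (cfg w (Rewind d c) i j (int j - int k) v)"
    using Suc.prems by (intro reach_step) (auto simp: unary_def)
  from reach_trans[OF this Suc.IH] Suc.prems show ?case
    by simp
qed

text \<open>One pass to the left over the \<open>j\<close> ones, one step to turn at the blank in
  cell -1, and one pass back.\<close>

lemma reach_copy:
  "reach \<alpha> (2 * j + 1) (cfg w (Emit d c) i j (int j - 1) v) (cfg w (Rewind d c) i j (int j) (v @ replicate j 1))"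
proof -
  have "reach \<alpha> 1 (cfg w (Emit d c) i j (-1) (v @ replicate j 1)) (cfg w (Rewind d c) i j 0 (v @ replicate j 1))"
    by (intro reach_step) (auto simp: unary_def)
  from reach_trans[OF reach_trans[OF reach_emit[of j j] this] reach_rewind[of j j, simplified]]
  show ?thesis
    by (rule reach_mono) auto
qed

text \<open>Three copies take \<open>3 * (2 * j + 1)\<close> steps and the transitions between them
  2 more. The first opening symbol 3 is written on entry; those two transitions write the
  others.\<close>

lemma reach_three:
  "reach \<alpha> (6 * j + 5) (cfg w (Emit d First) i j (int j - 1) (v @ [3]))
     (cfg w (Rewind d Third) i j (int j) (v @ concat (map enc_letter (cube j))))"
proof -
  have next1: "reach \<alpha> 1 (cfg w (Rewind d First) i j (int j) v) (cfg w (Emit d Second) i j (int j - 1) (v @ [3]))" for v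
    by (intro reach_step) (auto simp: unary_def)
  have next2: "reach \<alpha> 1 (cfg w (Rewind d Second) i j (int j) v) (cfg w (Emit d Third) i j (int j - 1) (v @ [3]))" for v
    by (intro reach_step) (auto simp: unary_def)
  have "reach \<alpha> (2 * j + 1 + 1 + (2 * j + 1) + 1 + (2 * j + 1)) (cfg w (Emit d First) i j (int j - 1) (v @ [3]))
     (cfg w (Rewind d Third) i j (int j)
       (((((v @ [3]) @ replicate j 1) @ [3]) @ replicate j 1) @ [3] @ replicate j 1))"
    unfolding append_assoc[symmetric]
    by (intro reach_trans[OF reach_trans[OF reach_trans[OF reach_trans[OF reach_copy next1] reach_copy] next2] reach_copy])
  from reach_mono[OF this, of "6 * j + 5"] show ?thesis
    unfolding enc_cube by simp
qed

section \<open>Sweeps over the exponents of a monomial\<close>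

lemma unary_Suc: "(unary j)(int j := 1) = unary (Suc j)"
  by (auto simp: unary_def fun_eq_iff)

lemma unary_pred: "(unary (Suc j))(int j := 0) = unary j"
  by (auto simp: unary_def fun_eq_iff)

text \<open>The counter is the number of exponents passed, hence the index of the current variable.
  One exponent costs at most \<open>1 + (6 * j + 5) + 1\<close> steps with \<open>j < n\<close>;
  \<open>6 * n + 8\<close> is a bound shared with the backward sweep.\<close>

lemma reach_Fwd:
  assumes "w = u @ map (\<lambda>d. 4 + d) e @ x" "set e \<subseteq> {0, 1, 2}" "length e \<le> n"
  shows "reach \<alpha> (length e * (6 * n + 8)) (cfg w Fwd (int (length u)) 0 0 v)
    (cfg w Fwd (int (length u + length e)) (length e) (int (length e)) (v @ concat (map enc_letter (sign_word e))))"
  using assms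
proof (induction e arbitrary: x rule: rev_induct)
  case Nil
  then show ?case by (simp add: reach_refl)
next
  case (snoc d e)
  let ?i = "int (length u + length e)" and ?j = "length e"
  let ?v = "v @ concat (map enc_letter (sign_word e))"
  have d: "tape_content w ?i = 4 + d"
    using tape_content_append[of "u @ map (\<lambda>d. 4 + d) e" "4 + d" x] snoc.prems(1) by simp
  have last: "reach \<alpha> (6 * n + 8) (cfg w Fwd ?i ?j (int ?j) ?v)
    (cfg w Fwd (?i + 1) (Suc ?j) (int ?j + 1) (?v @ (if d = 1 then concat (map enc_letter (cube ?j)) else [])))"
  proof (cases "d = 1")
    case True
    have "reach \<alpha> 1 (cfg w Fwd ?i ?j (int ?j) ?v) (cfg w (Emit True First) ?i ?j (int ?j - 1) (?v @ [3]))"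
      by (rule reach_step) (auto simp: d[simplified] True)
    moreover have "reach \<alpha> 1 (cfg w (Rewind True Third) ?i ?j (int ?j) v') (cfg w Fwd (?i + 1) (Suc ?j) (int ?j + 1) v')" for v'
      by (rule reach_step[where s = 1, OF _ _ unary_Suc]) (auto simp: unary_def)
    ultimately have "reach \<alpha> (1 + (6 * ?j + 5) + 1) (cfg w Fwd ?i ?j (int ?j) ?v)
      (cfg w Fwd (?i + 1) (Suc ?j) (int ?j + 1) (?v @ concat (map enc_letter (cube ?j))))"
      by (rule reach_trans[OF reach_trans[OF _ reach_three]])
    then show ?thesis
      using True snoc.prems(3) by (auto elim: reach_mono)
  next
    case False
    then have "reach \<alpha> 1 (cfg w Fwd ?i ?j (int ?j) ?v) (cfg w Fwd (?i + 1) (Suc ?j) (int ?j + 1) ?v)"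
      using snoc.prems(2) by (intro reach_step[where s = 1, OF _ _ unary_Suc]) (auto simp: d[simplified])
    then show ?thesis
      using False by (auto elim: reach_mono)
  qed
  have "reach \<alpha> (length e * (6 * n + 8)) (cfg w Fwd (int (length u)) 0 0 v) (cfg w Fwd ?i ?j (int ?j) ?v)"
    using snoc by (intro snoc.IH[of "(4 + d) # x"]) auto
  from reach_trans[OF this last] show ?case
    by (auto simp: sign_word_snoc algebra_simps)
qed

text \<open>The last exponent is visited first, and cubes are palindromes, so the output is the
  reversed word. The input head starts on the last exponent and ends on the cell before the first
  one.\<close>

lemma reach_Bwd:
  assumes "w = u @ map (\<lambda>d. 4 + d) e @ x" "set e \<subseteq> {0, 1, 2}" "length e \<le> n"
  shows "reach \<alpha> (length e * (6 * n + 8))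
    (cfg w Bwd (int (length u + length e) - 1) (length e) (int (length e)) v)
    (cfg w Bwd (int (length u) - 1) 0 0 (v @ concat (map enc_letter (rev (sign_word e)))))"
  using assms
proof (induction e arbitrary: x v rule: rev_induct)
  case Nil
  then show ?case by (simp add: reach_refl)
next
  case (snoc d e)
  let ?i = "int (length u + length e)" and ?j = "length e"
  have d: "tape_content w ?i = 4 + d"
    using tape_content_append[of "u @ map (\<lambda>d. 4 + d) e" "4 + d" x] snoc.prems(1) by simp
  define v' where "v' = v @ (if d = 1 then concat (map enc_letter (cube ?j)) else [])"
  \<comment> \<open>The counter head rests on the blank after the last 1, so a decrement first steps
    left and then erases; the counter is then the index of the exponent being read.\<close>
  have "reach \<alpha> 1 (cfg w Bwd ?i (Suc ?j) (int ?j + 1) v) (cfg w Dec ?i (Suc ?j) (int ?j) v)"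
    using snoc.prems(2) by (intro reach_step) (auto simp: d[simplified])
  moreover have "reach \<alpha> (6 * n + 7) (cfg w Dec ?i (Suc ?j) (int ?j) v) (cfg w Bwd (?i - 1) ?j (int ?j) v')"
  proof (cases "d = 1")
    case True
    have "reach \<alpha> 1 (cfg w Dec ?i (Suc ?j) (int ?j) v) (cfg w (Emit False First) ?i ?j (int ?j - 1) (v @ [3]))"
      by (rule reach_step[where s = 0, OF _ _ unary_pred]) (auto simp: d[simplified] True)
    moreover have "reach \<alpha> 1 (cfg w (Rewind False Third) ?i ?j (int ?j) v') (cfg w Bwd (?i - 1) ?j (int ?j) v')" for v'
      by (rule reach_step) (auto simp: unary_def)
    ultimately have "reach \<alpha> (1 + (6 * ?j + 5) + 1) (cfg w Dec ?i (Suc ?j) (int ?j) v)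
      (cfg w Bwd (?i - 1) ?j (int ?j) (v @ concat (map enc_letter (cube ?j))))"
      by (rule reach_trans[OF reach_trans[OF _ reach_three]])
    then show ?thesis
      using True snoc.prems(3) by (auto simp: v'_def elim: reach_mono)
  next
    case False
    then have "reach \<alpha> 1 (cfg w Dec ?i (Suc ?j) (int ?j) v) (cfg w Bwd (?i - 1) ?j (int ?j) v)"
      using snoc.prems(2) by (intro reach_step[where s = 0, OF _ _ unary_pred]) (auto simp: d[simplified])
    then show ?thesis
      using False by (auto simp: v'_def elim: reach_mono)
  qed
  moreover have "reach \<alpha> (length e * (6 * n + 8)) (cfg w Bwd (?i - 1) ?j (int ?j) v')
      (cfg w Bwd (int (length u) - 1) 0 0 (v' @ concat (map enc_letter (rev (sign_word e)))))"
    using snoc.prems by (intro snoc.IH[of "(4 + d) # x"]) auto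
  ultimately have "reach \<alpha> (1 + (6 * n + 7) + length e * (6 * n + 8)) (cfg w Bwd ?i (Suc ?j) (int ?j + 1) v)
      (cfg w Bwd (int (length u) - 1) 0 0 (v' @ concat (map enc_letter (rev (sign_word e)))))"
    using reach_trans by blast
  then show ?case
    by (auto simp: sign_word_snoc v'_def cube_def algebra_simps split: if_splits)
qed

lemma reach_Skip:
  assumes "w = u @ map (\<lambda>d. 4 + d) e @ x" "set e \<subseteq> {0, 1, 2}"
  shows "reach \<alpha> (length e) (cfg w Skip (int (length u)) 0 0 v) (cfg w Skip (int (length u + length e)) 0 0 v)"
  using assms
proof (induction e arbitrary: x rule: rev_induct)
  case Nil
  then show ?case by (simp add: reach_refl)
next
  case (snoc d e)
  have d: "tape_content w (int (length u + length e)) = 4 + d"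
    using tape_content_append[of "u @ map (\<lambda>d. 4 + d) e" "4 + d" x] snoc.prems(1) by simp
  have "reach \<alpha> 1 (cfg w Skip (int (length u + length e)) 0 0 v)
      (cfg w Skip (int (length u + length (e @ [d]))) 0 0 v)"
    using snoc.prems(2) by (intro reach_step) (auto simp: d[simplified])
  moreover have "reach \<alpha> (length e) (cfg w Skip (int (length u)) 0 0 v) (cfg w Skip (int (length u + length e)) 0 0 v)"
    using snoc.prems by (intro snoc.IH[of "(4 + d) # x"]) auto
  ultimately show ?case
    using reach_trans by fastforce
qed

text \<open>The run starts and ends in \<open>Main\<close> with an empty counter, so monomials can
  be chained. Its steps add up to at most \<open>12 * n * n + 17 * n + 4\<close>, below the bound
  \<open>(n + 2) * (12 * n + 20)\<close>.\<close>

lemma reach_monomial: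
  assumes w: "w = u @ enc_monomial m @ x" and m: "set (fst m) \<subseteq> {0, 1, 2}" "length (fst m) = n"
  shows "reach \<alpha> (length (enc_monomial m) * (12 * n + 20)) (cfg w Main (int (length u)) 0 0 v)
    (cfg w Main (int (length (u @ enc_monomial m))) 0 0 (v @ concat (map enc_letter (monomial_word \<alpha> m))))"
proof -
  obtain e c where ec: "m = (e, c)" by force
  define s :: nat where "s = (if c = 1 then 7 else 8)"
  define A where "A = (if c = 1 then \<alpha> else \<alpha> ** \<alpha>)"
  let ?u = "u @ [3]" and ?x = "s # x"
  let ?f = "concat (map enc_letter (sign_word e))" and ?b = "concat (map enc_letter (rev (sign_word e)))"
  have e: "w = ?u @ map (\<lambda>d. 4 + d) e @ ?x" "set e \<subseteq> {0, 1, 2}" "length e \<le> n" "length e = n"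
    using assms by (auto simp: ec enc_monomial_def s_def)
  have three: "tape_content w (int (length u)) = 3"
    using tape_content_append[of u 3] e(1) by simp
  have s: "tape_content w (int (length ?u + n)) = s"
    using tape_content_append[of "?u @ map (\<lambda>d. 4 + d) e" s x] e(1,4) by simp
  have 1: "reach \<alpha> 1 (cfg w Main (int (length u)) 0 0 v) (cfg w Fwd (int (length ?u)) 0 0 v)"
    by (rule reach_step) (auto simp: three)
  have 2: "reach \<alpha> (n * (6 * n + 8)) (cfg w Fwd (int (length ?u)) 0 0 v)
      (cfg w Fwd (int (length ?u + n)) n (int n) (v @ ?f))"
    using reach_Fwd[OF e(1-3)] e(4) by simp
  have 3: "reach \<alpha> 1 (cfg w Fwd (int (length ?u + n)) n (int n) (v @ ?f))
      (cfg w Bwd (int (length ?u + n) - 1) n (int n) (v @ ?f @ [4 + mat_code A]))"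
    by (cases "c = 1"; rule reach_step) (auto simp: s[simplified] s_def A_def)
  have 4: "reach \<alpha> (n * (6 * n + 8))
      (cfg w Bwd (int (length ?u + n) - 1) n (int n) (v @ ?f @ [4 + mat_code A]))
      (cfg w Bwd (int (length u)) 0 0 (v @ ?f @ [4 + mat_code A] @ ?b))"
    using reach_Bwd[OF e(1-3), of \<alpha> "v @ ?f @ [4 + mat_code A]"] e(4) by simp
  \<comment> \<open>The opening symbol 3 ends the backward sweep; the input head must then cross the
    monomial again to reach the next item.\<close>
  have 5: "reach \<alpha> 1 (cfg w Bwd (int (length u)) 0 0 v') (cfg w Skip (int (length ?u)) 0 0 v')" for v'
    by (rule reach_step) (auto simp: three)
  have 6: "reach \<alpha> n (cfg w Skip (int (length ?u)) 0 0 v') (cfg w Skip (int (length ?u + n)) 0 0 v')" for v'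
    using reach_Skip[OF e(1,2)] e(4) by fastforce
  have 7: "reach \<alpha> 1 (cfg w Skip (int (length ?u + n)) 0 0 v') (cfg w Main (int (length ?u + n + 1)) 0 0 v')" for v'
    by (rule reach_step) (auto simp: s[simplified] s_def)
  have out: "v @ ?f @ [4 + mat_code A] @ ?b = v @ concat (map enc_letter (monomial_word \<alpha> m))"
    by (simp add: monomial_word_def ec A_def)
  have len: "length ?u + n + 1 = length (u @ enc_monomial m)" "length (enc_monomial m) = n + 2"
    by (simp_all add: enc_monomial_def ec e(4))
  note r = reach_trans[OF reach_trans[OF reach_trans[OF reach_trans[OF reach_trans[OF reach_trans
    [OF 1 2] 3] 4] 5] 6] 7, unfolded out len(1)]
  show ?thesis
    by (rule reach_mono[OF r]) (simp add: len(2) algebra_simps)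
qed

section \<open>Assembly of the complete run\<close>

text \<open>Serves both for the monomials of a polynomial and for the polynomials of the input: a
  cost of \<open>K\<close> steps per input symbol is additive under concatenation.\<close>

lemma reach_concat:
  assumes "\<And>u y x v. y \<in> set ys \<Longrightarrow> w = u @ f y @ x \<Longrightarrow>
      reach \<alpha> (length (f y) * K) (cfg w Main (int (length u)) 0 0 v) (cfg w Main (int (length (u @ f y))) 0 0 (v @ g y))"
    and "w = u @ concat (map f ys) @ x"
  shows "reach \<alpha> (length (concat (map f ys)) * K) (cfg w Main (int (length u)) 0 0 v)
    (cfg w Main (int (length (u @ concat (map f ys)))) 0 0 (v @ concat (map g ys)))"
  using assms
proof (induction ys arbitrary: u v)
  case Nil
  then show ?case by (simp add: reach_refl)
next
  case (Cons y ys)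
  have "reach \<alpha> (length (f y) * K) (cfg w Main (int (length u)) 0 0 v)
      (cfg w Main (int (length (u @ f y))) 0 0 (v @ g y))"
    using Cons.prems(2) by (intro Cons.prems(1)[where x = "concat (map f ys) @ x"]) auto
  moreover have "reach \<alpha> (length (concat (map f ys)) * K) (cfg w Main (int (length (u @ f y))) 0 0 (v @ g y))
    (cfg w Main (int (length ((u @ f y) @ concat (map f ys)))) 0 0 ((v @ g y) @ concat (map g ys)))"
  proof (rule Cons.IH)
    show "w = (u @ f y) @ concat (map f ys) @ x"
      using Cons.prems(2) by simp
  qed (use Cons.prems(1) in \<open>simp del: append_assoc length_append\<close>)
  ultimately show ?case
    using reach_trans by (fastforce simp: algebra_simps)
qed

lemma reach_xpoly:
  assumes w: "w = u @ enc_xpoly p @ x" and p: "expanded_poly n p"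
  shows "reach \<alpha> (length (enc_xpoly p) * (12 * n + 20)) (cfg w Main (int (length u)) 0 0 v)
    (cfg w Main (int (length (u @ enc_xpoly p))) 0 0 (v @ enc_word (xpoly_word \<alpha> p)))"
proof -
  have two: "tape_content w (int (length u)) = 2"
    using tape_content_append[of u 2] w by (simp add: enc_xpoly_def)
  \<comment> \<open>A transition appends at most one symbol, so \<open>Open\<close> separates the
    symbol 2 from the leading identity matrix. Both steps are charged to the symbol that opens the
    polynomial.\<close>
  have 1: "reach \<alpha> 1 (cfg w Main (int (length u)) 0 0 v) (cfg w Open (int (length u)) 0 0 (v @ [2]))"
    by (rule reach_step) (auto simp: two)
  have 2: "reach \<alpha> 1 (cfg w Open (int (length u)) 0 0 (v @ [2]))
      (cfg w Main (int (length (u @ [2]))) 0 0 (v @ [2, 4 + mat_code (mat 1)]))"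
    by (rule reach_step) (auto simp: two)
  have 3: "reach \<alpha> (length (concat (map enc_monomial p)) * (12 * n + 20))
      (cfg w Main (int (length (u @ [2]))) 0 0 (v @ [2, 4 + mat_code (mat 1)]))
      (cfg w Main (int (length ((u @ [2]) @ concat (map enc_monomial p)))) 0 0
        ((v @ [2, 4 + mat_code (mat 1)]) @ concat (map (\<lambda>m. concat (map enc_letter (monomial_word \<alpha> m))) p)))"
  proof (rule reach_concat)
    show "w = (u @ [2]) @ concat (map enc_monomial p) @ x"
      using w by (simp add: enc_xpoly_def)
  next
    fix u m x v assume "m \<in> set p" "w = u @ enc_monomial m @ x"
    moreover have "set (fst m) \<subseteq> {0, 1, 2}" "length (fst m) = n"
      using p \<open>m \<in> set p\<close> by (fastforce simp: expanded_poly_def)+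
    ultimately show "reach \<alpha> (length (enc_monomial m) * (12 * n + 20)) (cfg w Main (int (length u)) 0 0 v)
        (cfg w Main (int (length (u @ enc_monomial m))) 0 0 (v @ concat (map enc_letter (monomial_word \<alpha> m))))"
      using reach_monomial by blast
  qed
  have out: "(v @ [2, 4 + mat_code (mat 1)]) @ concat (map (\<lambda>m. concat (map enc_letter (monomial_word \<alpha> m))) p)
      = v @ enc_word (xpoly_word \<alpha> p)"
    by (simp add: enc_word_def xpoly_word_def map_concat o_def) (induction p; simp)
  have len: "(u @ [2]) @ concat (map enc_monomial p) = u @ enc_xpoly p"
    by (simp add: enc_xpoly_def)
  show ?thesis
    by (rule reach_mono[OF reach_trans[OF reach_trans[OF 1 2] 3, unfolded out len]])
      (simp add: enc_xpoly_def)
qed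

lemma reach_ones:
  assumes "w = replicate n 1 @ x" "k \<le> n"
  shows "reach \<alpha> k (cfg w Main 0 0 0 []) (cfg w Main (int k) 0 0 (replicate k 1))"
  using assms(2)
proof (induction k)
  case 0
  then show ?case by (simp add: reach_refl)
next
  case (Suc k)
  have "tape_content w (int k) = 1"
    using Suc.prems assms(1) by (simp add: tape_content_def nth_append)
  then have "reach \<alpha> 1 (cfg w Main (int k) 0 0 (replicate k 1)) (cfg w Main (int (Suc k)) 0 0 (replicate (Suc k) 1))"
    by (intro reach_step) (auto simp: replicate_append_same)
  from reach_trans[OF Suc.IH this] Suc.prems show ?case
    by simp
qed

lemma machine_computes_reduction:
  assumes "e \<in> inputs (sigma_problem \<alpha>)"
  defines "w \<equiv> encode (sigma_problem \<alpha>) e"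
  shows "tm_computes_within (machine \<alpha>) w (encode restricted_equivalence_problem (reduction \<alpha> e))
    (poly [:1, 21, 12:] (length w))"
proof -
  obtain n ps where e: "e = (n, ps)" by force
  have w: "w = replicate n 1 @ concat (map enc_xpoly ps)"
    by (simp add: w_def e sigma_problem_def)
  define v where "v = replicate n 1 @ concat (map (enc_word \<circ> xpoly_word \<alpha>) ps)"
  have v: "encode restricted_equivalence_problem (reduction \<alpha> e) = v"
    by (simp add: e reduction_def restricted_equivalence_problem_def v_def)
  have ps: "expanded_poly n p" if "p \<in> set ps" for p
    using assms that by (simp add: e sigma_problem_def)
  have 1: "reach \<alpha> n (cfg w Main 0 0 0 []) (cfg w Main (int (length (replicate n (1::nat)))) 0 0 (replicate n 1))"
    using reach_ones[OF w order_refl] by simp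
  have 2: "reach \<alpha> (length (concat (map enc_xpoly ps)) * (12 * n + 20))
      (cfg w Main (int (length (replicate n (1::nat)))) 0 0 (replicate n 1))
      (cfg w Main (int (length w)) 0 0 v)"
    unfolding v_def w comp_def
    by (rule reach_concat[where x = "[]"]) (auto intro!: reach_xpoly[OF _ ps, simplified])
  \<comment> \<open>The blank behind the input sends \<open>Main\<close> to
    \<open>Halt\<close>.\<close>
  have 3: "reach \<alpha> 1 (cfg w Main (int (length w)) 0 0 v) (cfg w Halt (int (length w)) 0 0 v)"
    by (rule reach_step) (auto simp: tape_content_end)
  \<comment> \<open>For inputs of length \<open>L\<close>, copying the unary digits takes
    \<open>n \<le> L\<close> steps, the polynomials at most \<open>L * (12 * L + 20)\<close>, and
    halting one.\<close>
  have le: "n + length (concat (map enc_xpoly ps)) * (12 * n + 20) + 1 \<le> poly [:1, 21, 12:] (length w)"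
  proof -
    have "length (concat (map enc_xpoly ps)) * (12 * n + 20) \<le> length w * (12 * length w + 20)"
      by (intro mult_mono) (auto simp: w)
    moreover have "n \<le> length w"
      by (simp add: w)
    ultimately show ?thesis
      by (simp add: algebra_simps)
  qed
  have start: "start_config (machine \<alpha>) w = cfg w Main 0 0 0 []"
    by (simp add: start_config_def cfg_def machine_def eval_nat_numeral tape_content_def unary_def fun_eq_iff)
  have "reach \<alpha> (poly [:1, 21, 12:] (length w)) (start_config (machine \<alpha>) w) (cfg w Halt (int (length w)) 0 0 v)"
    unfolding start by (rule reach_mono[OF reach_trans[OF reach_trans[OF 1 2] 3] le])
  then show ?thesis
    unfolding v tm_computes_within_def reach_def by (force simp: cfg_def)
qed

section \<open>Alphabets of the encodings and conclusion\<close>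

lemma sigma_symbols:
  assumes "e \<in> inputs (sigma_problem \<alpha>)"
  shows "set (encode (sigma_problem \<alpha>) e) \<subseteq> {1..<20}"
proof -
  have mon: "set (enc_monomial m) \<subseteq> {1..<20}" if "set (fst m) \<subseteq> {0, 1, 2}" for m
    using that by (auto simp: enc_monomial_def)
  have "set (enc_xpoly p) \<subseteq> {1..<20}" if "expanded_poly n p" for n p
  proof -
    have "set (enc_monomial m) \<subseteq> {1..<20}" if "m \<in> set p" for m
      using that \<open>expanded_poly n p\<close> by (intro mon) (fastforce simp: expanded_poly_def)
    then show ?thesis
      unfolding enc_xpoly_def by simp blast
  qed
  then have "\<forall>p\<in>set ps. set (enc_xpoly p) \<subseteq> {1..<20}" if "e = (n, ps)" for n ps
    using assms that by (auto simp: sigma_problem_def)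
  then show ?thesis
    by (cases e) (simp add: sigma_problem_def UN_least set_replicate_conv_if)
qed

lemma restricted_symbols: "set (encode restricted_equivalence_problem e) \<subseteq> {1..<20}"
proof -
  have letter: "set (enc_letter l) \<subseteq> {1..<20}" for l
  proof (cases l)
    case (Const A)
    then show ?thesis using mat_code_less[of A] by simp
  qed auto
  have "set (enc_word u) \<subseteq> {1..<20}" for u
    using letter unfolding enc_word_def by simp blast
  then show ?thesis
    by (cases e) (simp add: restricted_equivalence_problem_def UN_least set_replicate_conv_if)
qed

theorem theorem6p6:
  fixes \<alpha> :: mat2
  assumes "primitive_F4 \<alpha>"
  shows "polytime_reducible (sigma_problem \<alpha>) restricted_equivalence_problem"
proof -
  have "polytime_transformation (sigma_problem \<alpha>) restricted_equivalence_problem (reduction \<alpha>)"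
    unfolding polytime_transformation_def
  proof (intro conjI exI ballI)
    show "wf_tm (machine \<alpha>)"
      by (rule wf_machine)
  next
    fix e assume e: "e \<in> inputs (sigma_problem \<alpha>)"
    show "reduction \<alpha> e \<in> inputs restricted_equivalence_problem"
      by (rule reduction_input[OF assms e])
    show "set (encode (sigma_problem \<alpha>) e) \<subseteq> {1..<symbols (machine \<alpha>)}"
      "set (encode restricted_equivalence_problem (reduction \<alpha> e)) \<subseteq> {1..<symbols (machine \<alpha>)}"
      using sigma_symbols[OF e] restricted_symbols by (simp_all add: machine_def)
    show "tm_computes_within (machine \<alpha>) (encode (sigma_problem \<alpha>) e)
        (encode restricted_equivalence_problem (reduction \<alpha> e))
        (poly [:1, 21, 12:] (length (encode (sigma_problem \<alpha>) e)))"
      by (rule machine_computes_reduction[OF e])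
  qed
  then show ?thesis
    unfolding polytime_reducible_def using reduction_correct[OF assms] by blast
qed

end
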